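(* Let $F$ be an unsatisfiable hitting clause-set. If $F$ contains no fs-pair, then $F$ has no nontrivial clause-factor $F'$ with $c(F')\le 4$. If $F$ has no full variable, then $F$ has no nontrivial clause-factor $F'$ with $c(F')\ge c(F)-3$.
   Context: Variables are positive integers, literals are nonzero integers, the complement of $x$ is $\overline{x}=-x$. A clause is a finite set of literals with no pair $x,\overline{x}$. A clause-set is a finite set of clauses; $\top$ is the empty clause-set; $c(F)=|F|$. $F$ is satisfiable if some clause meets every clause of $F$, otherwise unsatisfiable. $F$ is hitting if any two distinct clauses $C,D\in F$ have some $x\in C$ with $\overline{x}\in D$. An fs-pair is a pair of clauses $\{E\cup\{v\},E\cup\{\overline v\}\}$ with $v,\overline v\notin E$. A full variable of $F$ is a variable occurring (positively or negatively) in every clause of $F$. A clause-set $F'\ne\top$ is a clause-factor if $\{D\setminus\bigcap F':D\in F'\}$ is unsatisfiable; a clause-factor of $F$ is a subset $F'\subseteq F$ which is a clause-factor; it is trivial if $c(F')=1$ or ($F'$ unsatisfiable and $F'=F$), otherwise nontrivial. *)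

theory Defs
  imports Main
begin

type_synonym clause = "int set"
type_synonym clause_set = "int set set"

definition is_literal :: "int \<Rightarrow> bool" where
  "is_literal x \<longleftrightarrow> x \<noteq> 0"

definition is_variable :: "int \<Rightarrow> bool" where
  "is_variable v \<longleftrightarrow> v > 0"

definition is_clause :: "clause \<Rightarrow> bool" where
  "is_clause C \<longleftrightarrow> finite C \<and> (\<forall>x\<in>C. is_literal x) \<and> \<not> (\<exists>x\<in>C. - x \<in> C)"

definition is_clause_set :: "clause_set \<Rightarrow> bool" where
  "is_clause_set F \<longleftrightarrow> finite F \<and> (\<forall>C\<in>F. is_clause C)"

definition satisfiable :: "clause_set \<Rightarrow> bool" where
  "satisfiable F \<longleftrightarrow> (\<exists>C. is_clause C \<and> (\<forall>D\<in>F. C \<inter> D \<noteq> {}))"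

abbreviation unsatisfiable :: "clause_set \<Rightarrow> bool" where
  "unsatisfiable F \<equiv> \<not> satisfiable F"

definition hitting :: "clause_set \<Rightarrow> bool" where
  "hitting F \<longleftrightarrow> (\<forall>C\<in>F. \<forall>D\<in>F. C \<noteq> D \<longrightarrow> (\<exists>x\<in>C. - x \<in> D))"

definition fs_pair :: "clause_set \<Rightarrow> bool" where
  "fs_pair P \<longleftrightarrow> (\<exists>E v. is_clause E \<and> is_variable v \<and> v \<notin> E \<and> - v \<notin> E \<and>
     P = {E \<union> {v}, E \<union> {- v}})"

definition full_variable :: "clause_set \<Rightarrow> int \<Rightarrow> bool" where
  "full_variable F v \<longleftrightarrow> is_variable v \<and> (\<forall>C\<in>F. v \<in> C \<or> - v \<in> C)"

definition clause_factor :: "clause_set \<Rightarrow> bool" where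
  "clause_factor F' \<longleftrightarrow> is_clause_set F' \<and> F' \<noteq> {} \<and> unsatisfiable {D - \<Inter> F' | D. D \<in> F'}"

definition clause_factor_of :: "clause_set \<Rightarrow> clause_set \<Rightarrow> bool" where
  "clause_factor_of F' F \<longleftrightarrow> F' \<subseteq> F \<and> clause_factor F'"

definition trivial_factor_of :: "clause_set \<Rightarrow> clause_set \<Rightarrow> bool" where
  "trivial_factor_of F' F \<longleftrightarrow> clause_factor_of F' F \<and>
     (card F' = 1 \<or> (unsatisfiable F' \<and> F' = F))"

definition nontrivial_factor_of :: "clause_set \<Rightarrow> clause_set \<Rightarrow> bool" where
  "nontrivial_factor_of F' F \<longleftrightarrow> clause_factor_of F' F \<and> \<not> trivial_factor_of F' F"

end

theory Submission
  imports Defs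
begin

text \<open>
  An unsatisfiable hitting clause-set is the same as a finite set of clauses such that every total
  assignment falsifies exactly one of them. If a literal v occurs in only one clause, P together
  with v, then flipping v shows that every clause containing the complement of v contains P.
  Hence an unsatisfiable hitting clause-set with two to four clauses has a full variable, and,
  splitting on it, also an fs-pair. For a clause-factor F' of F with intersection C, both the
  residual clauses of F' after removing C, and F with F' replaced by the single clause C,
  are again unsatisfiable hitting; fs-pairs of the former and full variables of the latter
  lift to F.
\<close>

text \<open>A total assignment is given by its set of true literals, so it falsifies the clauses
  disjoint from it.\<close>

definition total_assignment :: "int set \<Rightarrow> bool" where
  "total_assignment S \<longleftrightarrow> (\<forall>x. x \<noteq> 0 \<longrightarrow> (x \<in> S \<longleftrightarrow> - x \<notin> S))"

text \<open>The assignments falsifying a clause form a subcube; these subcubes partition all total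
  assignments. Existence expresses unsatisfiability, uniqueness expresses hitting.\<close>

definition clause_partition :: "clause_set \<Rightarrow> bool" where
  "clause_partition G \<longleftrightarrow> is_clause_set G \<and>
     (\<forall>S. total_assignment S \<longrightarrow> (\<exists>!D. D \<in> G \<and> S \<inter> D = {}))"

section \<open>Assignments falsifying clauses\<close>

lemma is_clause_subset: "is_clause D \<Longrightarrow> C \<subseteq> D \<Longrightarrow> is_clause C"
  unfolding is_clause_def by (meson finite_subset subset_iff)

lemma is_clause_nonzero: "is_clause C \<Longrightarrow> x \<in> C \<Longrightarrow> x \<noteq> 0"
  unfolding is_clause_def is_literal_def by blast

lemma is_clause_no_complement: "is_clause C \<Longrightarrow> x \<in> C \<Longrightarrow> - x \<notin> C"
  unfolding is_clause_def by blast

lemma total_assignment_complement: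
  "total_assignment S \<Longrightarrow> x \<noteq> 0 \<Longrightarrow> - x \<in> S \<longleftrightarrow> x \<notin> S"
  unfolding total_assignment_def by metis

lemma falsifying_assignment_exists:
  assumes "is_clause C"
  obtains S where "total_assignment S" "S \<inter> C = {}"
proof
  \<comment> \<open>Complements of literals of \<open>C\<close> become true, and every variable not
    occurring in \<open>C\<close> is set to true.\<close>
  let ?S = "{x. x \<notin> C \<and> (x > 0 \<or> - x \<in> C)}"
  show "total_assignment ?S"
    using assms unfolding total_assignment_def is_clause_def by auto
  show "?S \<inter> C = {}" by auto
qed

text \<open>A satisfying clause is a finite partial assignment. A total assignment is cut down to
  the literals of \<open>G\<close> to become one, and a clause is extended to a total assignment
  containing it.\<close>

lemma unsatisfiable_iff_total:
  assumes G: "is_clause_set G"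
  shows "unsatisfiable G \<longleftrightarrow> (\<forall>S. total_assignment S \<longrightarrow> (\<exists>D\<in>G. S \<inter> D = {}))"
proof
  assume u: "unsatisfiable G"
  show "\<forall>S. total_assignment S \<longrightarrow> (\<exists>D\<in>G. S \<inter> D = {})"
  proof (intro allI impI)
    fix S assume S: "total_assignment S"
    have fin: "finite (\<Union>G)"
      using G unfolding is_clause_set_def is_clause_def by auto
    have nz: "x \<noteq> 0" if "x \<in> \<Union>G" for x
      using that G unfolding is_clause_set_def by (metis UnionE is_clause_nonzero)
    have "is_clause (S \<inter> \<Union>G)"
      unfolding is_clause_def
    proof (intro conjI)
      show "\<forall>x\<in>S \<inter> \<Union>G. is_literal x"
        using nz unfolding is_literal_def by blast
      show "\<not> (\<exists>x\<in>S \<inter> \<Union>G. - x \<in> S \<inter> \<Union>G)"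
        using total_assignment_complement[OF S nz] by blast
    qed (use fin in simp)
    then have "\<not> (\<forall>D\<in>G. S \<inter> \<Union>G \<inter> D \<noteq> {})"
      using u unfolding satisfiable_def by metis
    then obtain D where "D \<in> G" "S \<inter> \<Union>G \<inter> D = {}"
      by metis
    then show "\<exists>D\<in>G. S \<inter> D = {}" by blast
  qed
next
  assume r: "\<forall>S. total_assignment S \<longrightarrow> (\<exists>D\<in>G. S \<inter> D = {})"
  show "unsatisfiable G"
  proof
    assume "satisfiable G"
    then obtain C where C: "is_clause C" "\<forall>D\<in>G. C \<inter> D \<noteq> {}"
      unfolding satisfiable_def by metis
    \<comment> \<open>Falsifying all complements of literals in \<open>C\<close> forces
      \<open>C \<subseteq> S\<close>.\<close>
    have "is_clause (uminus ` C)"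
      using C(1) unfolding is_clause_def is_literal_def by auto
    then obtain S where S: "total_assignment S" "S \<inter> uminus ` C = {}"
      by (rule falsifying_assignment_exists)
    have "C \<subseteq> S"
    proof
      fix x assume x: "x \<in> C"
      then have "- x \<notin> S" using S(2) by blast
      then show "x \<in> S"
        using total_assignment_complement[OF S(1) is_clause_nonzero[OF C(1) x]] by blast
    qed
    moreover obtain D where "D \<in> G" "S \<inter> D = {}" using r S(1) by metis
    ultimately show False using C(2) by blast
  qed
qed

lemma total_assignment_flip:
  assumes "total_assignment S" "v \<noteq> 0"
  shows "total_assignment (insert v (S - {- v}))"
  unfolding total_assignment_def
proof (intro allI impI)
  fix x :: int assume "x \<noteq> 0"
  then show "x \<in> insert v (S - {- v}) \<longleftrightarrow> - x \<notin> insert v (S - {- v})"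
    using total_assignment_complement[OF assms(1), of x] assms(2) by auto
qed

text \<open>If \<open>x\<close> in \<open>P\<close> were missing from \<open>D\<close>, then
  \<open>D\<close> with \<open>- x\<close> added would still be a clause, and an assignment
  falsifying it would falsify \<open>D\<close> but not \<open>P\<close>.\<close>

lemma clause_subset_if_falsified:
  assumes D: "is_clause D" and P: "is_clause P"
    and imp: "\<And>S. total_assignment S \<Longrightarrow> S \<inter> D = {} \<Longrightarrow> S \<inter> P = {}"
  shows "P \<subseteq> D"
proof
  fix x assume x: "x \<in> P"
  show "x \<in> D"
  proof (rule ccontr)
    assume nx: "x \<notin> D"
    have x0: "x \<noteq> 0" using P x by (rule is_clause_nonzero)
    have "is_clause (insert (- x) D)"
      using D nx x0 unfolding is_clause_def is_literal_def by auto
    then obtain S where S: "total_assignment S" "S \<inter> insert (- x) D = {}"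
      by (rule falsifying_assignment_exists)
    then have "x \<in> S" using total_assignment_complement[OF S(1) x0] by blast
    then show False using imp[OF S(1)] S(2) x by blast
  qed
qed

lemma hitting_falsified_unique:
  assumes F: "is_clause_set F" and h: "hitting F" and S: "total_assignment S"
    and "C \<in> F" "D \<in> F" "S \<inter> C = {}" "S \<inter> D = {}"
  shows "C = D"
proof (rule ccontr)
  assume "C \<noteq> D"
  then obtain x where x: "x \<in> C" "- x \<in> D"
    using h assms(4,5) unfolding hitting_def by blast
  have "x \<noteq> 0"
    using F assms(4) x(1) is_clause_nonzero unfolding is_clause_set_def by blast
  then show False using total_assignment_complement[OF S] x assms(6,7) by blast
qed

section \<open>Clashes and flips in clause partitions\<close>

lemma clause_partition_if_unsat_hitting:
  assumes "is_clause_set G" "unsatisfiable G" "hitting G"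
  shows "clause_partition G"
  using assms hitting_falsified_unique[OF assms(1,3)]
  unfolding clause_partition_def unsatisfiable_iff_total[OF assms(1)] by blast

lemma clause_partition_clause: "clause_partition G \<Longrightarrow> D \<in> G \<Longrightarrow> is_clause D"
  unfolding clause_partition_def is_clause_set_def by blast

lemma clause_partition_finite: "clause_partition G \<Longrightarrow> finite G"
  unfolding clause_partition_def is_clause_set_def by blast

lemma clause_partition_falsified:
  assumes "clause_partition G" "total_assignment S"
  obtains D where "D \<in> G" "S \<inter> D = {}"
  using assms unfolding clause_partition_def by blast

lemma clause_partition_unique:
  assumes "clause_partition G" "total_assignment S"
    "C \<in> G" "S \<inter> C = {}" "D \<in> G" "S \<inter> D = {}"
  shows "C = D"
  using assms unfolding clause_partition_def by blast

text \<open>Without a clash, \<open>C \<union> D\<close> would be a clause, and an assignment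
  falsifying it would falsify two members of \<open>G\<close>.\<close>

lemma clause_partition_clash:
  assumes G: "clause_partition G" and CD: "C \<in> G" "D \<in> G" "C \<noteq> D"
  obtains x where "x \<in> C" "- x \<in> D"
proof -
  have "\<exists>x\<in>C. - x \<in> D"
  proof (rule ccontr)
    assume "\<not> (\<exists>x\<in>C. - x \<in> D)"
    then have n: "\<And>x. x \<in> C \<Longrightarrow> - x \<notin> D" by blast
    then have n': "\<And>x. x \<in> D \<Longrightarrow> - x \<notin> C" by force
    have "is_clause (C \<union> D)"
      using clause_partition_clause[OF G CD(1)] clause_partition_clause[OF G CD(2)] n n'
      unfolding is_clause_def by auto
    then obtain S where "total_assignment S" "S \<inter> (C \<union> D) = {}"
      by (rule falsifying_assignment_exists)
    then show False
      using clause_partition_unique[OF G _ CD(1) _ CD(2)] CD(3) by blast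
  qed
  then show thesis using that by blast
qed

text \<open>Making \<open>- v\<close> true satisfies \<open>D\<close>, so another clause becomes the
  falsified one. It must contain \<open>v\<close>, since otherwise \<open>S\<close> would already
  falsify it.\<close>

lemma clause_partition_flip:
  assumes G: "clause_partition G" and D: "D \<in> G" "- v \<in> D"
    and S: "total_assignment S" "S \<inter> D = {}"
  shows "\<exists>D'\<in>G. v \<in> D' \<and> S \<inter> (D' - {v}) = {}"
proof -
  have cD: "is_clause D" using G D(1) by (rule clause_partition_clause)
  have v0: "- v \<noteq> 0" using cD D(2) by (rule is_clause_nonzero)
  have "total_assignment (insert (- v) (S - {v}))"
    using total_assignment_flip[OF S(1) v0] by simp
  then obtain D' where D': "D' \<in> G" "insert (- v) (S - {v}) \<inter> D' = {}"
    by (rule clause_partition_falsified[OF G])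
  have "v \<in> D'"
  proof (rule ccontr)
    assume "v \<notin> D'"
    then have "S \<inter> D' = {}" using D'(2) by blast
    then have "D' = D"
      using clause_partition_unique[OF G S(1) D'(1) _ D(1) S(2)] by blast
    then show False using D(2) D'(2) by blast
  qed
  then show ?thesis using D' by blast
qed

lemma clause_partition_complement_occurs:
  assumes G: "clause_partition G" and D: "D \<in> G" "v \<in> D"
  obtains D' where "D' \<in> G" "- v \<in> D'"
proof -
  obtain S where "total_assignment S" "S \<inter> D = {}"
    using clause_partition_clause[OF G D(1)] by (rule falsifying_assignment_exists)
  then show thesis
    using clause_partition_flip[OF G D(1), of "- v"] D(2) that by auto
qed

text \<open>Flipping an assignment that falsifies \<open>D'\<close> can only lead to
  \<open>D\<close>, so that assignment falsifies \<open>D - {v}\<close> too; such an implication is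
  an inclusion of clauses.\<close>

lemma clause_partition_single_occurrence:
  assumes G: "clause_partition G" and D: "{X \<in> G. v \<in> X} = {D}"
    and D': "D' \<in> G" "- v \<in> D'"
  shows "D - {v} \<subseteq> D'"
proof (rule clause_subset_if_falsified)
  have "D \<in> G" using D by blast
  then show "is_clause (D - {v})"
    using clause_partition_clause[OF G] is_clause_subset by blast
  show "is_clause D'" using G D'(1) by (rule clause_partition_clause)
  show "S \<inter> (D - {v}) = {}" if "total_assignment S" "S \<inter> D' = {}" for S
    using clause_partition_flip[OF G D' that] D by blast
qed

section \<open>Full literals of partitions with at most four clauses\<close>

lemma card_2_distinct_cover:
  assumes "finite N" "card N \<le> 2" "a \<in> N" "b \<in> N" "a \<noteq> b"
  shows "N = {a, b}"
proof -
  have "{a, b} \<subseteq> N" "card N \<le> card {a, b}" using assms by auto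
  then show ?thesis using card_seteq[OF assms(1)] by blast
qed

text \<open>Unlike in \<open>full_variable\<close>, no sign is fixed, so that \<open>v\<close> and
  \<open>- v\<close> can be treated alike.\<close>

definition full_literal :: "clause_set \<Rightarrow> int \<Rightarrow> bool" where
  "full_literal G v \<longleftrightarrow> (\<forall>C\<in>G. v \<in> C \<or> - v \<in> C)"

text \<open>Some clause \<open>B\<close> with \<open>- v\<close> contains \<open>?P\<close>. Without
  a full literal, each literal of \<open>?P\<close> needs two clauses besides \<open>B\<close> and
  \<open>D\<close>, which exhausts \<open>G\<close>; these two clauses are then too small to clash
  with each other.\<close>

lemma full_literal_if_unique_occurrence:
  assumes G: "clause_partition G" and c: "card G \<le> 4"
    and one: "{X \<in> G. v \<in> X} = {D}"
  shows "\<exists>w. w \<noteq> 0 \<and> full_literal G w"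
proof (rule ccontr)
  assume nofull: "\<not> (\<exists>w. w \<noteq> 0 \<and> full_literal G w)"
  let ?P = "D - {v}"
  have fin: "finite G" using G by (rule clause_partition_finite)
  have D: "D \<in> G" "v \<in> D" using one by blast+
  have cD: "is_clause D" using G D(1) by (rule clause_partition_clause)
  have v0: "v \<noteq> 0" using cD D(2) by (rule is_clause_nonzero)
  obtain B where B: "B \<in> G" "- v \<in> B"
    using G D by (rule clause_partition_complement_occurs)
  have PB: "?P \<subseteq> B" using clause_partition_single_occurrence[OF G one B] .
  have cB: "is_clause B" using G B(1) by (rule clause_partition_clause)
  have vB: "v \<notin> B" using is_clause_no_complement[OF cB B(2)] by simp
  then have BD: "B \<noteq> D" using D by blast
  let ?N = "G - {B, D}"
  have "card ?N = card G - 2"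
    using B(1) D(1) BD fin by (simp add: card_Diff_subset)
  then have cN: "card ?N \<le> 2" using c by simp
  have finN: "finite ?N" using fin by simp
  \<comment> \<open>\<open>B\<close> and \<open>D\<close> contain \<open>w\<close>, so the clause
    with \<open>- w\<close> and the clause free of both signs lie outside them.\<close>
  have occ: "\<exists>M\<in>?N. - w \<in> M \<and> (\<exists>M'\<in>?N. M' \<noteq> M \<and> w \<notin> M' \<and> - w \<notin> M')"
    if w: "w \<in> ?P" for w
  proof -
    have w0: "w \<noteq> 0" using is_clause_nonzero[OF cD] w by blast
    obtain M where M: "M \<in> G" "- w \<in> M"
      using clause_partition_complement_occurs[OF G D(1)] w by blast
    have "M \<noteq> D" using M(2) is_clause_no_complement[OF cD] w by blast
    moreover have "M \<noteq> B" using M(2) is_clause_no_complement[OF cB] PB w by blast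
    ultimately have MN: "M \<in> ?N" using M(1) by blast
    obtain M' where M': "M' \<in> G" "w \<notin> M'" "- w \<notin> M'"
      using nofull w0 unfolding full_literal_def by blast
    then have "M' \<in> ?N" "M' \<noteq> M" using w PB M(2) by blast+
    then show ?thesis using MN M(2) M'(2,3) by blast
  qed
  have "?P \<noteq> {}"
  proof
    assume "?P = {}"
    then have Dv: "D = {v}" using D(2) by blast
    have "full_literal G v"
      unfolding full_literal_def
    proof
      fix C assume C: "C \<in> G"
      show "v \<in> C \<or> - v \<in> C"
      proof (cases "C = D")
        case False
        then obtain x where "x \<in> D" "- x \<in> C"
          using clause_partition_clash[OF G D(1) C] by blast
        then show ?thesis using Dv by simp
      qed (use D in simp)
    qed
    then show False using nofull v0 by blast
  qed
  then obtain w where w: "w \<in> ?P" by blast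
  from occ[OF w] obtain M M' where M: "M \<in> ?N" "- w \<in> M"
    and M': "M' \<in> ?N" "M' \<noteq> M" "w \<notin> M'" "- w \<notin> M'" by blast
  have N: "?N = {M, M'}"
    using card_2_distinct_cover[OF finN cN M(1) M'(1)] M'(2) by blast
  then have Geq: "G = {B, D, M, M'}" using B(1) D(1) by blast
  \<comment> \<open>The single occurrence of \<open>- u\<close> puts the rest of \<open>X\<close>
    into both \<open>D\<close> and \<open>B\<close>, which share only \<open>?P\<close> because
    \<open>v \<notin> B\<close>.\<close>
  have incl: "X \<subseteq> insert (- u) ?P"
    if X: "{Y \<in> G. - u \<in> Y} = {X}" and u: "u \<in> ?P" for X u
  proof -
    have "X - {- u} \<subseteq> D"
      using clause_partition_single_occurrence[OF G X D(1)] u by simp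
    moreover have "X - {- u} \<subseteq> B"
      using clause_partition_single_occurrence[OF G X B(1)] u PB by auto
    ultimately show ?thesis using vB by blast
  qed
  have negB: "- u \<notin> B \<and> - u \<notin> D" if "u \<in> ?P" for u
    using that PB is_clause_no_complement[OF cB] is_clause_no_complement[OF cD] by blast
  have oneM: "{Y \<in> G. - w \<in> Y} = {M}"
    using Geq M(2) M'(4) negB[OF w] by auto
  have sM: "M \<subseteq> insert (- w) ?P" using incl[OF oneM w] .
  have GM': "M' \<in> G" "M \<in> G" using M M' by blast+
  have "D \<noteq> M'" using M'(1) by blast
  obtain z where z: "z \<in> D" "- z \<in> M'"
    using G D(1) GM'(1) \<open>D \<noteq> M'\<close> by (rule clause_partition_clash)
  show False
  proof (cases "z = v")
    case False
    then have zP: "z \<in> ?P" using z by blast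
    \<comment> \<open>As \<open>- z\<close> lies in \<open>M'\<close>, the clause free of both signs
      of \<open>z\<close> can only be \<open>M\<close>.\<close>
    from occ[OF zP] N have zM: "z \<notin> M" "- z \<notin> M"
      using z(2) is_clause_no_complement[OF clause_partition_clause[OF G GM'(1)] z(2)] by auto
    have oneM': "{Y \<in> G. - z \<in> Y} = {M'}"
      using Geq z(2) zM negB[OF zP] by auto
    have sM': "M' \<subseteq> insert (- z) ?P" using incl[OF oneM' zP] .
    \<comment> \<open>The two inclusions leave only clashes on the variables of \<open>w\<close> and
      \<open>z\<close>, but \<open>w\<close> is missing from \<open>M'\<close> and \<open>z\<close>
      from \<open>M\<close>.\<close>
    obtain x where x: "x \<in> M" "- x \<in> M'"
      using G GM'(2,1) M'(2)[symmetric] by (rule clause_partition_clash)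
    have "x \<noteq> - w" using x(2) M'(3) by auto
    then have xP: "x \<in> ?P" using sM x(1) by blast
    then have "- x \<notin> ?P" using negB by blast
    then have "x = z" using sM' x(2) by force
    then show False using x(1) zM by blast
  next
    case True
    have "D - {v} \<subseteq> M'"
      using clause_partition_single_occurrence[OF G one GM'(1)] z(2) True by blast
    then show False using w M'(3) by blast
  qed
qed

text \<open>Take a clash on \<open>v\<close>. If \<open>v\<close> is not full, at most three clauses
  contain \<open>v\<close> or \<open>- v\<close>, so one of these literals occurs exactly
  once.\<close>

lemma clause_partition_full_literal:
  assumes G: "clause_partition G" and c: "2 \<le> card G" "card G \<le> 4"
  obtains w where "w \<noteq> 0" "full_literal G w"
proof -
  have fin: "finite G" using G by (rule clause_partition_finite)
  obtain C D where CD: "C \<in> G" "D \<in> G" "C \<noteq> D"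
    using c(1) by (metis card_le_Suc0_iff_eq fin not_less_eq_eq numeral_2_eq_2)
  obtain v where v: "v \<in> C" "- v \<in> D"
    using G CD by (rule clause_partition_clash)
  have v0: "v \<noteq> 0"
    using clause_partition_clause[OF G CD(1)] v(1) by (rule is_clause_nonzero)
  have "\<exists>w. w \<noteq> 0 \<and> full_literal G w"
  proof (cases "full_literal G v")
    case False
    then obtain E where E: "E \<in> G" "v \<notin> E" "- v \<notin> E"
      unfolding full_literal_def by blast
    let ?A = "{X \<in> G. v \<in> X}" and ?B = "{X \<in> G. - v \<in> X}"
    have disj: "?A \<inter> ?B = {}"
      using clause_partition_clause[OF G] is_clause_no_complement by blast
    have "?A \<union> ?B \<subseteq> G - {E}" using E by blast
    then have "card (?A \<union> ?B) \<le> card (G - {E})" by (intro card_mono) (use fin in auto)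
    also have "\<dots> \<le> 3" using E(1) fin c(2) by simp
    finally have "card ?A + card ?B \<le> 3"
      using card_Un_disjoint[OF _ _ disj] fin by simp
    moreover have "card ?A > 0" "card ?B > 0"
      using CD v fin by (auto simp: card_gt_0_iff)
    ultimately have "card ?A = 1 \<or> card ?B = 1" by linarith
    then obtain X u where "{Y \<in> G. u \<in> Y} = {X}" by (meson card_1_singletonE)
    then show ?thesis by (rule full_literal_if_unique_occurrence[OF G c(2)])
  qed (use v0 in blast)
  then show thesis using that by blast
qed

section \<open>Splitting on a full literal, and complementary pairs\<close>

text \<open>This is the restriction to \<open>v\<close> false. Clauses with \<open>- v\<close> are
  satisfied, and by fullness all others contain \<open>v\<close>.\<close>

lemma clause_partition_restrict:
  assumes G: "clause_partition G" and full: "full_literal G v" and v0: "v \<noteq> 0"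
  shows "clause_partition ((\<lambda>D. D - {v}) ` {X \<in> G. v \<in> X})"
  unfolding clause_partition_def
proof (intro conjI allI impI)
  show "is_clause_set ((\<lambda>D. D - {v}) ` {X \<in> G. v \<in> X})"
    using clause_partition_finite[OF G] clause_partition_clause[OF G] is_clause_subset
    unfolding is_clause_set_def by fastforce
  fix S assume S: "total_assignment S"
  let ?S = "insert (- v) (S - {v})"
  have tS: "total_assignment ?S" using total_assignment_flip[OF S, of "- v"] v0 by simp
  have eq: "S \<inter> (D - {v}) = {} \<longleftrightarrow> ?S \<inter> D = {}" if "D \<in> G" "v \<in> D" for D
    using is_clause_no_complement[OF clause_partition_clause[OF G that(1)] that(2)] v0 by auto
  obtain D where D: "D \<in> G" "?S \<inter> D = {}"
    using G tS by (rule clause_partition_falsified)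
  have vD: "v \<in> D" using full D unfolding full_literal_def by blast
  show "\<exists>!E. E \<in> (\<lambda>D. D - {v}) ` {X \<in> G. v \<in> X} \<and> S \<inter> E = {}"
  proof (rule ex1I[of _ "D - {v}"])
    show "D - {v} \<in> (\<lambda>D. D - {v}) ` {X \<in> G. v \<in> X} \<and> S \<inter> (D - {v}) = {}"
      using D vD eq by blast
    fix E assume "E \<in> (\<lambda>D. D - {v}) ` {X \<in> G. v \<in> X} \<and> S \<inter> E = {}"
    then obtain D' where D': "D' \<in> G" "v \<in> D'" "E = D' - {v}" "S \<inter> (D' - {v}) = {}" by blast
    have "?S \<inter> D' = {}" using eq[OF D'(1,2)] D'(4) by blast
    then have "D' = D" using clause_partition_unique[OF G tS D'(1) _ D] by blast
    then show "E = D - {v}" using D' by simp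
  qed
qed

text \<open>A side of the split with at least two clauses is a smaller partition. If both sides are
  single clauses, single occurrence in both directions shows that they differ only in the sign of
  \<open>v\<close>.\<close>

lemma clause_partition_complementary_pair:
  assumes "clause_partition G" "2 \<le> card G" "card G \<le> 4"
  shows "\<exists>E x. insert x E \<in> G \<and> insert (- x) E \<in> G"
  using assms
proof (induction "card G" arbitrary: G rule: less_induct)
  case less
  note G = less.prems(1)
  have fin: "finite G" using G by (rule clause_partition_finite)
  obtain v where v: "v \<noteq> 0" "full_literal G v"
    using less.prems by (rule clause_partition_full_literal)
  have split: "?case"
    if u: "u \<noteq> 0" "full_literal G u" and c: "2 \<le> card {X \<in> G. u \<in> X}"
      and D: "D \<in> G" "- u \<in> D" for u D
  proof -
    let ?A = "{X \<in> G. u \<in> X}"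
    let ?H = "(\<lambda>D. D - {u}) ` ?A"
    have "u \<notin> D"
      using is_clause_no_complement[OF clause_partition_clause[OF G D(1)] D(2)] by simp
    then have "?A \<subset> G" using D(1) by blast
    then have lt: "card ?A < card G" using fin by (rule psubset_card_mono[rotated])
    have inj: "inj_on (\<lambda>D. D - {u}) ?A" by (rule inj_onI) auto
    have cH: "card ?H = card ?A" using inj by (rule card_image)
    obtain E x where Ex: "insert x E \<in> ?H" "insert (- x) E \<in> ?H"
      using less.hyps[of ?H] clause_partition_restrict[OF G u(2,1)] lt c less.prems(3)
      unfolding cH by auto
    \<comment> \<open>All clauses of \<open>?A\<close> contain \<open>u\<close>, so the removed
      literal can be restored.\<close>
    have "insert y (insert u E) \<in> G" if y: "insert y E \<in> ?H" for y
    proof -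
      obtain D where "D \<in> G" "u \<in> D" "insert y E = D - {u}"
        using y by blast
      then have "insert y (insert u E) = D" by blast
      then show ?thesis using \<open>D \<in> G\<close> by simp
    qed
    then show ?thesis using Ex by blast
  qed
  let ?A = "{X \<in> G. v \<in> X}" and ?B = "{X \<in> G. - v \<in> X}"
  have "G \<noteq> {}" using less.prems(2) by auto
  then obtain D where "D \<in> G" "v \<in> D \<or> - v \<in> D"
    using v(2) unfolding full_literal_def by blast
  then obtain A B where A: "A \<in> G" "v \<in> A" and B: "B \<in> G" "- v \<in> B"
    using clause_partition_complement_occurs[OF G, of D v]
      clause_partition_complement_occurs[OF G, of D "- v"] by (metis minus_minus)
  have full': "full_literal G (- v)" using v(2) unfolding full_literal_def by auto
  consider "2 \<le> card ?A" | "2 \<le> card ?B" | "card ?A \<le> 1" "card ?B \<le> 1" by linarith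
  then show ?case
  proof cases
    case 1 then show ?thesis using split[OF v _ B] by blast
  next
    case 2 then show ?thesis using split[OF _ full' _ A(1)] v(1) A(2) by simp
  next
    case 3
    have sA: "?A = {A}" and sB: "?B = {B}"
      using 3 A B fin by (auto simp: card_le_Suc0_iff_eq)
    have "A - {v} \<subseteq> B" using clause_partition_single_occurrence[OF G sA B] .
    moreover have "B - {- v} \<subseteq> A"
      using clause_partition_single_occurrence[OF G sB A(1)] A(2) by simp
    ultimately have "insert (- v) (A - {v}) = B"
      using A(2) B is_clause_no_complement[OF clause_partition_clause[OF G B(1)] B(2)] by auto
    moreover have "insert v (A - {v}) = A" using A(2) by blast
    ultimately show ?thesis using A(1) B(1) by metis
  qed
qed

lemma complementary_pair_fs_pair:
  assumes F: "is_clause_set F" and x: "insert x E \<in> F" "insert (- x) E \<in> F"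
  shows "\<exists>P. fs_pair P \<and> P \<subseteq> F"
proof -
  have c: "is_clause (insert x E)" "is_clause (insert (- x) E)"
    using F x unfolding is_clause_set_def by blast+
  have E: "is_clause E" using c(1) by (rule is_clause_subset) blast
  have nx: "x \<noteq> 0" "x \<notin> E" "- x \<notin> E"
    using is_clause_nonzero[OF c(1)] is_clause_no_complement[OF c(1), of x]
      is_clause_no_complement[OF c(2), of x] by auto
  \<comment> \<open>\<open>fs_pair\<close> asks for a positive variable; changing the sign of
    \<open>x\<close> only swaps the two clauses.\<close>
  define v where "v = \<bar>x\<bar>"
  have "is_variable v" "v \<notin> E" "- v \<notin> E" "{E \<union> {v}, E \<union> {- v}} \<subseteq> F"
    using nx x unfolding v_def is_variable_def by (auto simp: abs_if)
  then show ?thesis using E unfolding fs_pair_def by blast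
qed

section \<open>Residue and contraction of a clause-factor\<close>

text \<open>Hitting survives because a clashing literal and its complement are each missing from one
  of the two clauses, hence from \<open>\<Inter>F'\<close>.\<close>

lemma clause_factor_residue_partition:
  assumes h: "hitting F" and sub: "F' \<subseteq> F" and cf: "clause_factor F'"
  shows "clause_partition ((\<lambda>D. D - \<Inter>F') ` F')"
proof (rule clause_partition_if_unsat_hitting)
  have F': "is_clause_set F'" using cf unfolding clause_factor_def by blast
  show "is_clause_set ((\<lambda>D. D - \<Inter>F') ` F')"
    using F' is_clause_subset unfolding is_clause_set_def by fastforce
  have "{D - \<Inter>F' |D. D \<in> F'} = (\<lambda>D. D - \<Inter>F') ` F'" by blast
  then show "unsatisfiable ((\<lambda>D. D - \<Inter>F') ` F')"
    using cf unfolding clause_factor_def by simp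
  show "hitting ((\<lambda>D. D - \<Inter>F') ` F')"
    unfolding hitting_def
  proof (intro ballI impI)
    fix X Y assume "X \<in> (\<lambda>D. D - \<Inter>F') ` F'" "Y \<in> (\<lambda>D. D - \<Inter>F') ` F'" "X \<noteq> Y"
    then obtain C D where CD: "C \<in> F'" "D \<in> F'" "C \<noteq> D" "X = C - \<Inter>F'" "Y = D - \<Inter>F'"
      by blast
    then obtain x where x: "x \<in> C" "- x \<in> D"
      using h sub unfolding hitting_def by blast
    have "is_clause C" "is_clause D" using F' CD unfolding is_clause_set_def by blast+
    then have "- x \<notin> C" "x \<notin> D" using x is_clause_no_complement by fastforce+
    then show "\<exists>x\<in>X. - x \<in> Y" using x CD by blast
  qed
qed

lemma clause_factor_falsified:
  assumes cf: "clause_factor F'" and S: "total_assignment S" "S \<inter> \<Inter>F' = {}"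
  obtains D where "D \<in> F'" "S \<inter> D = {}"
proof -
  let ?G = "{D - \<Inter>F' |D. D \<in> F'}"
  have F': "is_clause_set F'" and u: "unsatisfiable ?G"
    using cf unfolding clause_factor_def by blast+
  have "?G = (\<lambda>D. D - \<Inter>F') ` F'" by blast
  then have "is_clause_set ?G"
    using F' is_clause_subset unfolding is_clause_set_def by fastforce
  then obtain D where "D \<in> F'" "S \<inter> (D - \<Inter>F') = {}"
    using u S(1) unsatisfiable_iff_total by blast
  then show thesis using that S(2) by blast
qed

text \<open>An assignment falsifies a clause of \<open>F'\<close> exactly when it falsifies
  \<open>\<Inter>F'\<close>, so this one clause can replace \<open>F'\<close>. The second conclusion
  makes the clause count of the contraction exact.\<close>

lemma clause_factor_contract_partition:
  assumes F: "clause_partition F" and sub: "F' \<subseteq> F" and cf: "clause_factor F'"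
  shows "clause_partition (insert (\<Inter>F') (F - F'))" and "\<Inter>F' \<notin> F - F'"
proof -
  let ?C = "\<Inter>F'"
  obtain E where E: "E \<in> F'" using cf unfolding clause_factor_def by blast
  have cC: "is_clause ?C"
    using clause_partition_clause[OF F, of E] E sub is_clause_subset by blast
  have only: "D \<in> F'" if S: "total_assignment S" "S \<inter> ?C = {}" and D: "D \<in> F" "S \<inter> D = {}" for S D
  proof -
    obtain D' where "D' \<in> F'" "S \<inter> D' = {}"
      using cf S by (rule clause_factor_falsified)
    then show ?thesis
      using clause_partition_unique[OF F S(1) D] sub by blast
  qed
  show "?C \<notin> F - F'"
    using falsifying_assignment_exists[OF cC] only by (metis DiffD1 DiffD2)
  show "clause_partition (insert ?C (F - F'))"
    unfolding clause_partition_def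
  proof (intro conjI allI impI)
    show "is_clause_set (insert ?C (F - F'))"
      using F cC unfolding clause_partition_def is_clause_set_def by blast
    fix S assume S: "total_assignment S"
    show "\<exists>!D. D \<in> insert ?C (F - F') \<and> S \<inter> D = {}"
    proof (cases "S \<inter> ?C = {}")
      case True
      then show ?thesis using only[OF S True] by blast
    next
      case False
      obtain D where D: "D \<in> F" "S \<inter> D = {}"
        using F S by (rule clause_partition_falsified)
      have "D \<notin> F'" using D(2) False by blast
      show ?thesis
      proof (rule ex1I[of _ D])
        show "D \<in> insert ?C (F - F') \<and> S \<inter> D = {}" using D \<open>D \<notin> F'\<close> by blast
        show "D' = D" if "D' \<in> insert ?C (F - F') \<and> S \<inter> D' = {}" for D'
          using clause_partition_unique[OF F S _ _ D] that False by blast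
      qed
    qed
  qed
qed

section \<open>Small and large clause-factors\<close>

lemma small_clause_factor_fs_pair:
  assumes F: "is_clause_set F" and h: "hitting F"
    and sub: "F' \<subseteq> F" and cf: "clause_factor F'" and c: "card F' \<noteq> 1" "card F' \<le> 4"
  shows "\<exists>P. fs_pair P \<and> P \<subseteq> F"
proof -
  let ?G = "(\<lambda>D. D - \<Inter>F') ` F'"
  have "finite F'" "F' \<noteq> {}" using cf unfolding clause_factor_def is_clause_set_def by blast+
  then have "card F' \<noteq> 0" by simp
  \<comment> \<open>Every clause of \<open>F'\<close> contains \<open>\<Inter>F'\<close>, so it is
    recovered from its residue.\<close>
  moreover have "inj_on (\<lambda>D. D - \<Inter>F') F'" by (rule inj_onI) blast
  ultimately have "2 \<le> card ?G" "card ?G \<le> 4" using c by (simp_all add: card_image)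
  then obtain E x where Ex: "insert x E \<in> ?G" "insert (- x) E \<in> ?G"
    using clause_partition_complementary_pair[OF clause_factor_residue_partition[OF h sub cf]]
    by blast
  have "insert y (\<Inter>F' \<union> E) \<in> F" if y: "insert y E \<in> ?G" for y
  proof -
    obtain D where "D \<in> F'" "insert y E = D - \<Inter>F'"
      using y by blast
    then have "insert y (\<Inter>F' \<union> E) = D" by blast
    then show ?thesis using \<open>D \<in> F'\<close> sub by blast
  qed
  from this[OF Ex(1)] this[OF Ex(2)] show ?thesis by (rule complementary_pair_fs_pair[OF F])
qed

text \<open>The contraction has \<open>card F - card F' + 1\<close> clauses; proper inclusion makes
  this at least 2, and the bound makes it at most 4.\<close>

lemma large_clause_factor_full_variable:
  assumes F: "clause_partition F" and sub: "F' \<subset> F" and cf: "clause_factor F'"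
    and c: "card F \<le> card F' + 3"
  shows "\<exists>v. full_variable F v"
proof -
  let ?H = "insert (\<Inter>F') (F - F')"
  have sub': "F' \<subseteq> F" using sub by blast
  note H = clause_factor_contract_partition[OF F sub' cf]
  have fin: "finite F" using F by (rule clause_partition_finite)
  then have finF': "finite F'" using sub' finite_subset by blast
  have "card F' < card F" using fin sub by (rule psubset_card_mono)
  moreover have "card ?H = Suc (card F - card F')"
    using H(2) fin finF' sub' by (simp add: card_Diff_subset)
  ultimately have "2 \<le> card ?H" "card ?H \<le> 4" using c by linarith+
  then obtain w where w: "w \<noteq> 0" "full_literal ?H w"
    using clause_partition_full_literal[OF H(1)] by blast
  \<comment> \<open>Fullness puts \<open>w\<close> or \<open>- w\<close> into
    \<open>\<Inter>F'\<close>, hence into every clause of \<open>F'\<close>.\<close>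
  have "full_literal F w"
    using w(2) unfolding full_literal_def by blast
  then have "full_variable F \<bar>w\<bar>"
    using w(1) unfolding full_variable_def full_literal_def is_variable_def
    by (auto simp: abs_if)
  then show ?thesis by blast
qed

theorem lemma19:
  fixes F :: clause_set
  assumes "is_clause_set F" and "unsatisfiable F" and "hitting F"
  shows "(\<not> (\<exists>P. fs_pair P \<and> P \<subseteq> F) \<longrightarrow>
            \<not> (\<exists>F'. nontrivial_factor_of F' F \<and> card F' \<le> 4)) \<and>
         (\<not> (\<exists>v. full_variable F v) \<longrightarrow>
            \<not> (\<exists>F'. nontrivial_factor_of F' F \<and> int (card F') \<ge> int (card F) - 3))"
proof -
  \<comment> \<open>As \<open>F\<close> is unsatisfiable, nontriviality excludes
    \<open>F' = F\<close>, so the inclusion is proper.\<close>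
  have nt: "F' \<subset> F" "clause_factor F'" "card F' \<noteq> 1" if "nontrivial_factor_of F' F" for F'
    using that assms(2)
    unfolding nontrivial_factor_of_def trivial_factor_of_def clause_factor_of_def by blast+
  have "\<exists>P. fs_pair P \<and> P \<subseteq> F" if "nontrivial_factor_of F' F" "card F' \<le> 4" for F'
    using small_clause_factor_fs_pair[OF assms(1,3)] nt[OF that(1)] that(2) by blast
  moreover have "\<exists>v. full_variable F v"
    if "nontrivial_factor_of F' F" "int (card F') \<ge> int (card F) - 3" for F'
  proof -
    have "card F \<le> card F' + 3" using that(2) by linarith
    then show ?thesis
      using large_clause_factor_full_variable[OF clause_partition_if_unsat_hitting[OF assms]]
        nt[OF that(1)] by blast
  qed
  ultimately show ?thesis by blast
qed

end
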